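(* Assume that $A=\operatorname{diag}(\lambda_1,\dots,\lambda_n)$ is a normal matrix (written in an orthonormal eigenbasis $e_1,\dots,e_n$) with pairwise distinct eigenvalues in general position. Then the critical set of $\rho$ on $\mathbb{CP}^{n-1}$ consists exactly of the following components: \begin{enumerate} \item $n$ isolated minima, namely the eigenlines $[e_1],\dots,[e_n]$; \item for every unordered pair $\{i,j\}$, one critical circle $T^1$ with \[ |u_i|^2=|u_j|^2=\tfrac12,\qquad u_k=0\quad(k\ne i,j); \] thus there are exactly $\binom n2$ pair circles; \item for every unordered triple $\{i,j,k\}$ such that $\lambda_i,\lambda_j,\lambda_k$ form an acute triangle, one critical two-torus $T^2$, whose squared moduli $|u_i|^2,|u_j|^2,|u_k|^2$ are the barycentric coordinates of the circumcenter of the triangle (and whose other coordinates vanish). \end{enumerate} There are no other critical points.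
   Context: For a unit vector $u=(u_1,\dots,u_n)^T\in\mathbb C^n$, $\rho(u)=\rho_A(u)=\|Au-(u^*Au)u\|^2$ is the squared Rayleigh residual; it is invariant under $u\mapsto e^{i\theta}u$ and descends to a smooth function on $\mathbb{CP}^{n-1}$. The eigenvalues $\lambda_1,\dots,\lambda_n\in\mathbb C$ are in general position if (1) no three eigenvalues are collinear; (2) no four eigenvalues are concyclic; (3) no triangle formed by three eigenvalues is right-angled. $T^k$ denotes the $k$-dimensional torus. *)

theory Defs
  imports "HOL-Analysis.Analysis"
begin

section \<open>Complex projective space\<close>

definition proportional :: "complex ^ 'n \<Rightarrow> complex ^ 'n \<Rightarrow> bool" where
  "proportional v w \<longleftrightarrow> v \<noteq> 0 \<and> w \<noteq> 0 \<and> (\<exists>c. w = c *s v)"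

lemma part_equivp_proportional: "part_equivp (proportional :: complex ^ 'n \<Rightarrow> _)"
proof (rule part_equivpI)
  have "proportional ((\<chi> i. 1) :: complex ^ 'n) (\<chi> i. 1)"
    unfolding proportional_def by (auto simp: vec_eq_iff intro!: exI[of _ 1])
  then show "\<exists>x :: complex ^ 'n. proportional x x" by blast
  show "symp (proportional :: complex ^ 'n \<Rightarrow> _)"
  proof (rule sympI)
    fix v w :: "complex ^ 'n"
    assume "proportional v w"
    then obtain c where c: "v \<noteq> 0" "w \<noteq> 0" "w = c *s v"
      by (auto simp: proportional_def)
    then have "c \<noteq> 0" by auto
    then have "v = inverse c *s w" using c by simp
    with c(1,2) show "proportional w v" unfolding proportional_def by blast
  qed
  show "transp (proportional :: complex ^ 'n \<Rightarrow> _)"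
    by (rule transpI) (auto simp: proportional_def vector_smult_assoc)
qed

text \<open>
  The type of lines in \<open>complex ^ 'n\<close>, i.e. complex projective space of dimension
  \<open>CARD('n) - 1\<close>: nonzero vectors up to nonzero complex scalars. For a nonzero vector \<open>v\<close>,
  \<open>line v\<close> is the class of \<open>v\<close>.
\<close>

quotient_type 'n cproj = "complex ^ 'n" / partial: "proportional :: complex ^ 'n \<Rightarrow> _"
  morphisms rep_line line
  by (rule part_equivp_proportional)

text \<open>The quotient topology.\<close>

instantiation cproj :: (finite) topological_space
begin

definition open_cproj :: "'a cproj set \<Rightarrow> bool" where
  "open_cproj U \<longleftrightarrow> open {v. v \<noteq> 0 \<and> line v \<in> U}"

instance
proof
  have "{v :: complex ^ 'a. v \<noteq> 0 \<and> line v \<in> UNIV} = - {0}" by auto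
  then show "open (UNIV :: 'a cproj set)" by (simp add: open_cproj_def open_Compl)
next
  fix S T :: "'a cproj set"
  assume "open S" "open T"
  then have "open ({v. v \<noteq> 0 \<and> line v \<in> S} \<inter> {v. v \<noteq> 0 \<and> line v \<in> T})"
    unfolding open_cproj_def by (rule open_Int)
  also have "{v. v \<noteq> 0 \<and> line v \<in> S} \<inter> {v. v \<noteq> 0 \<and> line v \<in> T} = {v. v \<noteq> 0 \<and> line v \<in> S \<inter> T}"
    by auto
  finally show "open (S \<inter> T)" by (simp add: open_cproj_def)
next
  fix K :: "'a cproj set set"
  assume "\<forall>S\<in>K. open S"
  then have "open (\<Union>S\<in>K. {v. v \<noteq> 0 \<and> line v \<in> S})"
    unfolding open_cproj_def by blast
  also have "(\<Union>S\<in>K. {v. v \<noteq> 0 \<and> line v \<in> S}) = {v. v \<noteq> 0 \<and> line v \<in> \<Union>K}"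
    by auto
  finally show "open (\<Union>K)" by (simp add: open_cproj_def)
qed

end

text \<open>
  The standard affine chart around a line \<open>[v]\<close> with \<open>v $ i \<noteq> 0\<close> identifies the line with its
  unique representative in the affine hyperplane \<open>{z. z $ i = 1}\<close>. A point is critical for \<open>f\<close>
  if, read in every standard chart around the point, \<open>f\<close> is differentiable there with derivative
  zero. Every line lies in the domain of at least one chart.
\<close>

definition critical_point :: "('n::finite cproj \<Rightarrow> real) \<Rightarrow> 'n cproj \<Rightarrow> bool" where
  "critical_point f L \<longleftrightarrow>
     (\<forall>i w. w $ i = 1 \<and> line w = L \<longrightarrow>
        ((\<lambda>z. f (line z)) has_derivative (\<lambda>_. 0)) (at w within {z. z $ i = 1}))"

definition critical_set :: "('n::finite cproj \<Rightarrow> real) \<Rightarrow> 'n cproj set" where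
  "critical_set f = {L. critical_point f L}"

section \<open>The squared Rayleigh residual\<close>

definition hermitian_inner :: "complex ^ 'n \<Rightarrow> complex ^ 'n \<Rightarrow> complex" where
  "hermitian_inner u v = (\<Sum>i\<in>UNIV. cnj (u $ i) * v $ i)"

definition rho :: "complex ^ 'n ^ 'n \<Rightarrow> complex ^ 'n \<Rightarrow> real" where
  "rho A u = (norm (A *v u - hermitian_inner u (A *v u) *s u))\<^sup>2"

lemma norm_vector_smult: "norm (c *s v) = norm c * norm (v :: complex ^ 'n)"
proof -
  have "norm (c *s v) = L2_set (\<lambda>i. norm c * norm (v $ i)) UNIV"
    by (simp add: norm_vec_def norm_mult)
  also have "\<dots> = norm c * norm v"
    by (simp add: norm_vec_def L2_set_right_distrib)
  finally show ?thesis .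
qed

lemma rho_phase:
  assumes "cmod c = 1"
  shows "rho A (c *s u) = rho A u"
proof -
  have cc: "cnj c * c = 1" using assms by (metis complex_norm_square mult.commute of_real_1 power_one)
  have Av: "A *v (c *s u) = c *s (A *v u)"
    by (simp add: matrix_vector_mult_def vec_eq_iff sum_distrib_left mult_ac)
  have "hermitian_inner (c *s u) (c *s (A *v u)) = (cnj c * c) * hermitian_inner u (A *v u)"
    unfolding hermitian_inner_def sum_distrib_left by (simp add: mult_ac)
  then have "hermitian_inner (c *s u) (c *s (A *v u)) = hermitian_inner u (A *v u)"
    by (simp only: cc mult_1_left)
  then have "A *v (c *s u) - hermitian_inner (c *s u) (A *v (c *s u)) *s (c *s u)
      = c *s (A *v u - hermitian_inner u (A *v u) *s u)"
    by (simp add: Av vec_eq_iff algebra_simps)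
  then show ?thesis
    unfolding rho_def by (simp only: norm_vector_smult assms mult_1_left)
qed

text \<open>The function induced by \<open>rho A\<close> (restricted to unit vectors) on projective space.\<close>

lift_definition proj_rho :: "complex ^ 'n ^ 'n \<Rightarrow> 'n cproj \<Rightarrow> real"
  is "\<lambda>A v. rho A (v /\<^sub>R norm v)"
proof -
  fix A :: "complex ^ 'n ^ 'n" and v w :: "complex ^ 'n"
  assume "proportional v w"
  then obtain c where c: "v \<noteq> 0" "w \<noteq> 0" "w = c *s v"
    by (auto simp: proportional_def)
  then have c0: "c \<noteq> 0" by auto
  have "w /\<^sub>R norm w = (c / cmod c) *s (v /\<^sub>R norm v)"
    using c0 c(1) unfolding vec_eq_iff vector_scaleR_component vector_smult_component
    by (simp add: c(3) norm_vector_smult scaleR_conv_of_real field_simps)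
  moreover have "cmod (c / cmod c) = 1" using c0 by (simp add: norm_divide)
  ultimately show "rho A (v /\<^sub>R norm v) = rho A (w /\<^sub>R norm w)"
    by (metis rho_phase)
qed

lemma proj_rho_line:
  assumes "norm u = 1"
  shows "proj_rho A (line u) = rho A u"
proof -
  have "proportional u u"
    using assms by (auto simp: proportional_def intro!: exI[of _ 1])
  then show ?thesis using assms by (simp add: proj_rho.abs_eq)
qed

definition diag_matrix :: "('n \<Rightarrow> complex) \<Rightarrow> complex ^ 'n ^ 'n" where
  "diag_matrix l = (\<chi> i j. if i = j then l i else 0)"

section \<open>Plane geometry\<close>

text \<open>The unoriented angle at \<open>b\<close> in the triangle \<open>a b c\<close> (with distinct vertices).\<close>

definition vertex_angle :: "complex \<Rightarrow> complex \<Rightarrow> complex \<Rightarrow> real" where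
  "vertex_angle a b c = arccos (((a - b) \<bullet> (c - b)) / (norm (a - b) * norm (c - b)))"

text \<open>A triangle is given by its set of vertices.\<close>

definition nondegenerate_triangle :: "complex set \<Rightarrow> bool" where
  "nondegenerate_triangle S \<longleftrightarrow> card S = 3 \<and> \<not> collinear S"

definition right_triangle :: "complex set \<Rightarrow> bool" where
  "right_triangle S \<longleftrightarrow> nondegenerate_triangle S \<and> (\<exists>a b c. S = {a, b, c} \<and> vertex_angle a b c = pi / 2)"

definition acute_triangle :: "complex set \<Rightarrow> bool" where
  "acute_triangle S \<longleftrightarrow> nondegenerate_triangle S \<and> (\<forall>a b c. S = {a, b, c} \<longrightarrow> vertex_angle a b c < pi / 2)"

definition concyclic :: "complex set \<Rightarrow> bool" where
  "concyclic S \<longleftrightarrow> (\<exists>z r. 0 < r \<and> S \<subseteq> sphere z r)"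

definition general_position :: "complex set \<Rightarrow> bool" where
  "general_position S \<longleftrightarrow>
     (\<forall>T\<subseteq>S. card T = 3 \<longrightarrow> \<not> collinear T) \<and>
     (\<forall>T\<subseteq>S. card T = 4 \<longrightarrow> \<not> concyclic T) \<and>
     (\<forall>T\<subseteq>S. card T = 3 \<longrightarrow> \<not> right_triangle T)"

text \<open>Meaningful for a triangle \<open>S\<close>, where exactly one such point exists.\<close>

definition circumcenter :: "complex set \<Rightarrow> complex" where
  "circumcenter S = (THE z. \<exists>r. S \<subseteq> sphere z r)"

definition barycentric_coordinates ::
    "('n \<Rightarrow> complex) \<Rightarrow> 'n set \<Rightarrow> ('n \<Rightarrow> real) \<Rightarrow> complex \<Rightarrow> bool" where
  "barycentric_coordinates l T b p \<longleftrightarrow> (\<Sum>i\<in>T. b i) = 1 \<and> (\<Sum>i\<in>T. b i *\<^sub>R l i) = p"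

section \<open>The critical components\<close>

definition eigenline :: "'n::finite \<Rightarrow> 'n cproj" where
  "eigenline i = line (axis i 1)"

definition pair_circle :: "'n::finite set \<Rightarrow> 'n cproj set" where
  "pair_circle P = {line u | u. norm u = 1 \<and>
     (\<forall>i\<in>P. (cmod (u $ i))\<^sup>2 = 1 / 2) \<and> (\<forall>k. k \<notin> P \<longrightarrow> u $ k = 0)}"

definition triple_torus :: "('n::finite \<Rightarrow> complex) \<Rightarrow> 'n set \<Rightarrow> 'n cproj set" where
  "triple_torus l T = {line u | u. norm u = 1 \<and>
     barycentric_coordinates l T (\<lambda>i. (cmod (u $ i))\<^sup>2) (circumcenter (l ` T)) \<and>
     (\<forall>m. m \<notin> T \<longrightarrow> u $ m = 0)}"

text \<open>The standard torus of dimension \<open>CARD('k)\<close>.\<close>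

definition torus :: "(complex ^ 'k) set" where
  "torus = {z. \<forall>i. cmod (z $ i) = 1}"

end

theory Submission
  imports Defs
begin

text \<open>
  On a unit vector \<open>u\<close>, the residual depends only on the weights \<open>p\<^sub>i = \<bar>u\<^sub>i\<bar>\<^sup>2\<close>: it is the variance
  \<open>\<Sum>\<^sub>i p\<^sub>i \<bar>l\<^sub>i - m\<bar>\<^sup>2\<close> of the eigenvalues, with \<open>m = \<Sum>\<^sub>i p\<^sub>i l\<^sub>i\<close> their mean. Its derivative at a
  representative \<open>w\<close> of a line, in the direction \<open>h\<close>, is
  \<open>(2 / \<bar>w\<bar>\<^sup>2) \<Sum>\<^sub>i (\<bar>l\<^sub>i - m\<bar>\<^sup>2 - v) (w\<^sub>i \<bullet> h\<^sub>i)\<close>, where \<open>v\<close> is the variance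
  (\<open>proj_rho_has_derivative\<close>). Testing with \<open>h\<close> along the coordinate \<open>w\<^sub>i\<close> shows that the line is
  critical iff all eigenvalues of nonzero weight lie on one circle (possibly of radius zero) around
  their own mean (\<open>critical_set_eq\<close>); such weights are called balanced below.

  The balanced weights are found from the size of their support. Four or more points would contain
  four concyclic eigenvalues, which general position forbids. One point carries all the mass. Two
  points are equidistant from a point of their segment only if this is the midpoint. For three
  points, which are not collinear, the mean is the circumcenter, and it has positive barycentric
  coordinates exactly when the triangle is acute; the coordinates are then unique. This is
  \<open>balanced_iff\<close>, and there are only finitely many balanced weights.

  The critical set is therefore a finite disjoint union of fibers of the weight map
  \<open>[u] \<mapsto> (\<bar>u\<^sub>i\<bar>\<^sup>2 / \<bar>u\<bar>\<^sup>2)\<^sub>i\<close>. The fiber over \<open>p\<close> consists of the choices of a phase for each coordinate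
  in the support of \<open>p\<close>, up to a common phase, so it is a torus of dimension one less than the size
  of the support (\<open>weight_torus_homeomorphic_torus\<close>). Fibers are closed and connected, and a finite
  disjoint union of nonempty closed connected sets has these sets as its components.
\<close>

section \<open>The topology of projective space\<close>

lemma line_eq_iff:
  assumes "v \<noteq> 0" "w \<noteq> 0"
  shows "line v = line w \<longleftrightarrow> (\<exists>c. w = c *s v)"
proof -
  have "proportional u u" if "u \<noteq> 0" for u :: "complex ^ 'n"
    using that by (auto simp: proportional_def intro!: exI[of _ 1])
  then show ?thesis
    using Quotient3_rel[OF Quotient3_cproj, of v w] assms by (auto simp: proportional_def)
qed

lemma line_cases:
  obtains v where "v \<noteq> 0" "L = line v"
  by (induct L rule: cproj.abs_induct) (auto simp: proportional_def)

lemma line_smult: "c \<noteq> 0 \<Longrightarrow> v \<noteq> 0 \<Longrightarrow> line (c *s v) = line v"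
  using line_eq_iff[of v "c *s v"] by (metis vector_mul_eq_0)

lemma continuous_on_line: "continuous_on (- {0 :: complex ^ 'n::finite}) line"
proof (subst continuous_on_open_vimage, simp add: open_Compl, intro allI impI)
  fix B :: "'n cproj set"
  assume "open B"
  moreover have "line -` B \<inter> - {0} = {v. v \<noteq> 0 \<and> line v \<in> B}" by auto
  ultimately show "open (line -` B \<inter> - {0})" by (simp add: open_cproj_def)
qed

lemma continuous_on_cprojI:
  fixes f :: "'n::finite cproj \<Rightarrow> 'a::topological_space"
  assumes "continuous_on (- {0}) (\<lambda>v. f (line v))"
  shows "continuous_on UNIV f"
proof (subst continuous_on_open_vimage, simp, intro allI impI)
  fix B :: "'a set"
  assume "open B"
  then have "open ((\<lambda>v. f (line v)) -` B \<inter> - {0})"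
    using assms continuous_on_open_vimage[of "- {0}" "\<lambda>v. f (line v)"] by (simp add: open_Compl)
  moreover have "(\<lambda>v. f (line v)) -` B \<inter> - {0} = {v. v \<noteq> 0 \<and> line v \<in> f -` B \<inter> UNIV}" by auto
  ultimately show "open (f -` B \<inter> UNIV)" by (simp add: open_cproj_def)
qed

text \<open>
  The orthogonal projector onto a line. It embeds projective space into a space of matrices, which
  gives both the Hausdorff property and the continuity of functions of the matrix entries.
\<close>

lift_definition projector :: "'n::finite cproj \<Rightarrow> complex ^ 'n ^ 'n"
  is "\<lambda>v. \<chi> a b. v $ a * cnj (v $ b) / of_real ((norm v)\<^sup>2)"
proof -
  fix v w :: "complex ^ 'n"
  assume "proportional v w"
  then obtain c where c: "v \<noteq> 0" "w \<noteq> 0" "w = c *s v"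
    by (auto simp: proportional_def)
  then have "c \<noteq> 0" by auto
  moreover have "of_real ((cmod c)\<^sup>2) = c * cnj c" by (rule complex_norm_square)
  ultimately show "(\<chi> a b. v $ a * cnj (v $ b) / complex_of_real ((norm v)\<^sup>2)) =
        (\<chi> a b. w $ a * cnj (w $ b) / complex_of_real ((norm w)\<^sup>2))"
    using c(1) by (simp add: c(3) vec_eq_iff norm_vector_smult power_mult_distrib)
qed

lemma projector_line:
  assumes "v \<noteq> 0"
  shows "projector (line v) $ a $ b = v $ a * cnj (v $ b) / of_real ((norm v)\<^sup>2)"
proof -
  have "proportional v v"
    using assms by (auto simp: proportional_def intro!: exI[of _ 1])
  then show ?thesis by (simp add: projector.abs_eq)
qed

lemma continuous_projector: "continuous_on UNIV (projector :: 'n::finite cproj \<Rightarrow> _)"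
proof (rule continuous_on_cprojI)
  let ?f = "\<lambda>v :: complex ^ 'n. \<chi> a b. v $ a * cnj (v $ b) / of_real ((norm v)\<^sup>2)"
  have "continuous_on (- {0}) ?f"
    by (intro continuous_on_vec_lambda continuous_on_divide continuous_on_mult continuous_on_cnj
        continuous_on_of_real continuous_on_power continuous_on_norm continuous_on_component
        continuous_on_id) auto
  then show "continuous_on (- {0}) (\<lambda>v :: complex ^ 'n. projector (line v))"
    by (rule continuous_on_eq) (simp add: vec_eq_iff projector_line)
qed

lemma inj_projector: "inj projector"
proof (rule injI)
  fix L M :: "'n::finite cproj"
  assume eq: "projector L = projector M"
  obtain v w where v: "v \<noteq> 0" "L = line v" and w: "w \<noteq> 0" "M = line w"
    by (metis line_cases)
  then obtain b where b: "w $ b \<noteq> 0" by (auto simp: vec_eq_iff)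
  \<comment> \<open>Column \<open>b\<close> of the projector is a nonzero multiple of the spanning vector.\<close>
  define c where "c = cnj (v $ b) * of_real ((norm w)\<^sup>2) / (cnj (w $ b) * of_real ((norm v)\<^sup>2))"
  have "w $ a = c * v $ a" for a
  proof -
    have "projector (line v) $ a $ b = projector (line w) $ a $ b" using eq v w by simp
    then show ?thesis using v(1) w(1) b by (simp add: projector_line c_def field_simps)
  qed
  then have "w = c *s v" by (simp add: vec_eq_iff)
  then show "L = M" using v w line_eq_iff[of v w] by auto
qed

instance cproj :: (finite) t2_space
proof
  fix L M :: "'a cproj"
  assume "L \<noteq> M"
  then have "projector L \<noteq> projector M" using inj_projector by (auto dest: injD)
  then obtain U V where "open U" "open V" "projector L \<in> U" "projector M \<in> V" "U \<inter> V = {}"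
    using hausdorff by metis
  moreover from this have "open (projector -` U)" "open (projector -` V)"
    using continuous_projector continuous_on_open_vimage[of UNIV projector] by auto
  ultimately show "\<exists>U V. open U \<and> open V \<and> L \<in> U \<and> M \<in> V \<and> U \<inter> V = {}"
    by (intro exI[of _ "projector -` U"] exI[of _ "projector -` V"]) auto
qed

section \<open>Weights and weight tori\<close>

text \<open>
  Read off from the diagonal of the projector, so that the weights inherit its independence of the
  representative and its continuity.
\<close>

definition weights :: "'n::finite cproj \<Rightarrow> real ^ 'n" where
  "weights L = (\<chi> i. Re (projector L $ i $ i))"

lemma weights_line: "v \<noteq> 0 \<Longrightarrow> weights (line v) $ i = (cmod (v $ i))\<^sup>2 / (norm v)\<^sup>2"
  by (simp add: weights_def projector_line flip: complex_norm_square of_real_power of_real_divide)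

lemma continuous_weights: "continuous_on UNIV weights"
  unfolding weights_def
  by (intro continuous_on_vec_lambda continuous_on_Re continuous_on_component continuous_projector)

lemma norm_squared_vec: "(norm v)\<^sup>2 = (\<Sum>i\<in>UNIV. (cmod (v $ i))\<^sup>2)"
  by (simp add: norm_vec_def L2_set_def sum_nonneg)

definition prob_vector :: "real ^ 'n \<Rightarrow> bool" where
  "prob_vector p \<longleftrightarrow> (\<forall>i. 0 \<le> p $ i) \<and> (\<Sum>i\<in>UNIV. p $ i) = 1"

lemma prob_vector_weights: "prob_vector (weights L)"
proof -
  obtain v where v: "v \<noteq> 0" "L = line v" by (rule line_cases)
  then have "(\<Sum>i\<in>UNIV. weights L $ i) = (norm v)\<^sup>2 / (norm v)\<^sup>2"
    by (simp add: weights_line norm_squared_vec flip: sum_divide_distrib)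
  then show ?thesis using v by (simp add: prob_vector_def weights_line)
qed

text \<open>
  A fiber of the weight map (the moment map of the torus action on projective space).
\<close>

definition weight_torus :: "real ^ 'n \<Rightarrow> 'n::finite cproj set" where
  "weight_torus p = {L. weights L = p}"

lemma norm_of_moduli:
  assumes "prob_vector p" "\<And>i. (cmod (u $ i))\<^sup>2 = p $ i"
  shows "norm u = 1"
proof -
  have "(norm u)\<^sup>2 = 1"
    using assms by (simp add: norm_squared_vec prob_vector_def)
  then show ?thesis by (simp add: power2_eq_1_iff) (metis norm_ge_zero not_one_le_zero neg_0_le_iff_le)
qed

lemma weight_torus_eq:
  assumes "prob_vector p"
  shows "weight_torus p = {line u | u. \<forall>i. (cmod (u $ i))\<^sup>2 = p $ i}"
proof safe
  fix L
  assume L: "L \<in> weight_torus p"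
  obtain v where v: "v \<noteq> 0" "L = line v" by (rule line_cases)
  define u where "u = of_real (inverse (norm v)) *s v"
  have "line u = L" unfolding u_def v by (rule line_smult) (use v in auto)
  moreover have "(cmod (u $ i))\<^sup>2 = p $ i" for i
    using L v by (auto simp: weight_torus_def weights_line u_def norm_mult norm_inverse
        power_mult_distrib divide_inverse power_inverse)
  ultimately show "\<exists>u. L = line u \<and> (\<forall>i. (cmod (u $ i))\<^sup>2 = p $ i)" by auto
next
  fix u
  assume u: "\<forall>i. (cmod (u $ i))\<^sup>2 = p $ i"
  then have n: "norm u = 1" using assms norm_of_moduli by blast
  then have "u \<noteq> 0" by auto
  then have "weights (line u) = p"
    using u n by (simp add: vec_eq_iff weights_line)
  then show "line u \<in> weight_torus p" by (simp add: weight_torus_def)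
qed

lemma closed_weight_torus: "closed (weight_torus p)"
proof -
  have "weight_torus p = weights -` {p}" by (auto simp: weight_torus_def)
  then show ?thesis
    using closed_vimage[OF closed_singleton continuous_weights] by simp
qed

text \<open>
  A fiber is a continuous image of the space of all vectors of angles.
\<close>

lemma
  fixes p :: "real ^ 'n::finite"
  assumes "prob_vector p"
  shows connected_weight_torus: "connected (weight_torus p)"
    and weight_torus_nonempty: "weight_torus p \<noteq> {}"
proof -
  define \<Phi> where "\<Phi> = (\<lambda>t :: real ^ 'n. (\<chi> i. of_real (sqrt (p $ i)) * cis (t $ i)) :: complex ^ 'n)"
  have mod: "(cmod (\<Phi> t $ i))\<^sup>2 = p $ i" for t i
    using assms by (simp add: \<Phi>_def norm_mult prob_vector_def)
  have nz: "\<Phi> t \<noteq> 0" for t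
    using norm_of_moduli[OF assms mod] by (metis norm_zero zero_neq_one)
  have "weight_torus p = line ` range \<Phi>"
  proof
    show "line ` range \<Phi> \<subseteq> weight_torus p"
      using mod by (auto simp: weight_torus_eq[OF assms])
    show "weight_torus p \<subseteq> line ` range \<Phi>"
    proof
      fix L assume "L \<in> weight_torus p"
      then obtain u where u: "L = line u" "\<And>i. (cmod (u $ i))\<^sup>2 = p $ i"
        by (auto simp: weight_torus_eq[OF assms])
      have "u = \<Phi> (\<chi> i. Arg (u $ i))"
      proof -
        have "u $ i = of_real (cmod (u $ i)) * cis (Arg (u $ i))" for i
          by (metis rcis_cmod_Arg rcis_def)
        moreover have "cmod (u $ i) = sqrt (p $ i)" for i
          using u(2)[of i] by (metis norm_ge_zero real_sqrt_unique)
        ultimately show ?thesis by (simp add: \<Phi>_def vec_eq_iff)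
      qed
      then show "L \<in> line ` range \<Phi>" using u(1) by blast
    qed
  qed
  moreover have "continuous_on UNIV \<Phi>"
    unfolding \<Phi>_def by (intro continuous_on_vec_lambda continuous_intros)
  then have "connected (range \<Phi>)"
    by (rule connected_continuous_image) (rule connected_UNIV)
  then have "connected (line ` range \<Phi>)"
    by (rule connected_continuous_image[rotated])
       (use nz in \<open>auto intro: continuous_on_subset[OF continuous_on_line]\<close>)
  ultimately show "connected (weight_torus p)" "weight_torus p \<noteq> {}" by auto
qed

lemma compact_torus: "compact (torus :: (complex ^ 'k) set)"
proof -
  have "torus = (\<Inter>i. (\<lambda>z :: complex ^ 'k. cmod (z $ i)) -` {1})"
    by (auto simp: torus_def)
  moreover have "closed ((\<lambda>z :: complex ^ 'k. cmod (z $ i)) -` {1})" for i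
    by (intro continuous_closed_vimage) (auto intro!: continuous_intros)
  ultimately have "closed (torus :: (complex ^ 'k) set)"
    by (metis (no_types, lifting) closed_INT)
  moreover have "bounded (torus :: (complex ^ 'k) set)"
    by (rule boundedI[of _ "sqrt (CARD('k))"]) (simp add: torus_def norm_vec_def L2_set_def)
  ultimately show ?thesis by (simp add: compact_eq_bounded_closed)
qed

text \<open>
  The common phase is normalised by making one coordinate \<open>a\<close> of the support positive; the phases of
  the other coordinates of the support then range over a torus. The resulting map is a continuous
  bijection from a compact space to a Hausdorff space.
\<close>

lemma weight_torus_homeomorphic_torus:
  fixes p :: "real ^ 'n"
  assumes p: "prob_vector p"
    and card: "card {i. p $ i \<noteq> 0} = Suc (CARD('k))"
  shows "weight_torus p homeomorphic (torus :: (complex ^ 'k) set)"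
proof -
  have "{i. p $ i \<noteq> 0} \<noteq> {}" using card by (metis card.empty nat.distinct(1))
  then obtain a where a: "p $ a \<noteq> 0" by auto
  then have "card ({i. p $ i \<noteq> 0} - {a}) = CARD('k)" using card by simp
  then obtain e :: "'k \<Rightarrow> 'n" where e: "bij_betw e UNIV ({i. p $ i \<noteq> 0} - {a})"
    using finite_same_card_bij[of "UNIV :: 'k set" "{i. p $ i \<noteq> 0} - {a}"] by auto
  then have inj: "inj e" and ran: "range e = {i. p $ i \<noteq> 0} - {a}"
    by (auto simp: bij_betw_def)
  \<comment> \<open>Outside the support the factor \<open>sqrt (p $ i)\<close> vanishes, so the value 1 only matters at \<open>a\<close>.\<close>
  define h where "h = (\<lambda>z :: complex ^ 'k. (\<chi> i. of_real (sqrt (p $ i)) *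
      (if i \<in> range e then z $ inv e i else 1)) :: complex ^ 'n)"
  have h_a: "h z $ a = of_real (sqrt (p $ a))" for z
    by (simp add: h_def ran)
  have h_e: "h z $ e k = of_real (sqrt (p $ e k)) * z $ k" for z k
    by (simp add: h_def inj)
  have p_e: "p $ e k \<noteq> 0" for k using ran by auto
  have nz: "h z \<noteq> 0" for z
    using h_a[of z] a by (metis of_real_eq_0_iff real_sqrt_eq_zero_cancel_iff zero_index)
  have "continuous_on torus h"
    unfolding h_def
    apply (intro continuous_on_vec_lambda continuous_intros)
    subgoal for i by (cases "i \<in> range e") (auto intro!: continuous_intros)
    done
  then have cont: "continuous_on torus (\<lambda>z. line (h z))"
    by (rule continuous_on_compose2[OF continuous_on_line]) (use nz in auto)
  have inj_h: "inj_on (\<lambda>z. line (h z)) torus"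
  proof (rule inj_onI)
    fix z y
    assume "line (h z) = line (h y)"
    then obtain c where c: "h y = c *s h z" using nz by (auto simp: line_eq_iff)
    have "c = 1" using h_a a c by (metis mult_cancel_right1 of_real_eq_0_iff
          real_sqrt_eq_zero_cancel_iff vector_smult_component)
    then have "h y $ e k = h z $ e k" for k using c by simp
    then show "z = y" using p_e by (simp add: h_e vec_eq_iff)
  qed
  have "(\<lambda>z. line (h z)) ` torus = weight_torus p"
  proof (intro equalityI subsetI)
    fix L
    assume "L \<in> (\<lambda>z. line (h z)) ` torus"
    then obtain z where z: "z \<in> torus" "L = line (h z)" by blast
    have "(cmod (h z $ i))\<^sup>2 = p $ i" for i
      using z(1) p by (simp add: h_def norm_mult torus_def prob_vector_def)
    then show "L \<in> weight_torus p" using z(2) by (auto simp: weight_torus_eq[OF p])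
  next
    fix L
    assume "L \<in> weight_torus p"
    then obtain u where u: "L = line u" "\<And>i. (cmod (u $ i))\<^sup>2 = p $ i"
      by (auto simp: weight_torus_eq[OF p])
    then have mod: "cmod (u $ i) = sqrt (p $ i)" for i
      by (metis norm_ge_zero real_sqrt_unique)
    \<comment> \<open>Rotating by this phase makes the coordinate \<open>a\<close> of \<open>u\<close> positive.\<close>
    define c where "c = of_real (sqrt (p $ a)) / u $ a"
    have ua: "u $ a \<noteq> 0" using u(2)[of a] a by auto
    have c1: "cmod c = 1" using mod[of a] ua a p by (simp add: c_def norm_divide prob_vector_def)
    define z :: "complex ^ 'k" where "z = (\<chi> k. c * u $ e k / of_real (sqrt (p $ e k)))"
    have "z \<in> torus" using c1 mod p_e p
      by (simp add: torus_def z_def norm_mult norm_divide prob_vector_def)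
    moreover have "h z = c *s u"
    proof -
      have "h z $ i = c * u $ i" for i
      proof -
        consider "i = a" | k where "i = e k" | "p $ i = 0" using ran by blast
        then show ?thesis
        proof cases
          case 1 then show ?thesis using ua by (simp add: h_a c_def)
        next
          case 2 then show ?thesis using p_e by (simp add: h_e z_def)
        next
          case 3 then show ?thesis using mod[of i] by (simp add: h_def)
        qed
      qed
      then show ?thesis by (simp add: vec_eq_iff)
    qed
    moreover have "line (c *s u) = L"
      unfolding u(1) by (rule line_smult) (use c1 ua in auto)
    ultimately show "L \<in> (\<lambda>z. line (h z)) ` torus" by (metis image_eqI)
  qed
  then have "(torus :: (complex ^ 'k) set) homeomorphic weight_torus p"
    using inj_h by (rule homeomorphic_compact[OF compact_torus cont])
  then show ?thesis by (rule homeomorphic_sym[THEN iffD1])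
qed

section \<open>The residual as a variance\<close>

definition mean :: "('n \<Rightarrow> complex) \<Rightarrow> real ^ 'n::finite \<Rightarrow> complex" where
  "mean l p = (\<Sum>i\<in>UNIV. p $ i *\<^sub>R l i)"

definition variance :: "('n \<Rightarrow> complex) \<Rightarrow> real ^ 'n::finite \<Rightarrow> real" where
  "variance l p = (\<Sum>i\<in>UNIV. p $ i * (cmod (l i - mean l p))\<^sup>2)"

lemma rho_diag_matrix:
  assumes "norm u = 1"
  shows "rho (diag_matrix l) u = variance l (\<chi> i. (cmod (u $ i))\<^sup>2)"
proof -
  let ?m = "mean l (\<chi> i. (cmod (u $ i))\<^sup>2)"
  have A: "(diag_matrix l *v u) $ i = l i * u $ i" for i
    by (simp add: diag_matrix_def matrix_vector_mult_def if_distrib[of "\<lambda>x. x * _"] cong: if_cong)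
  have "cnj (u $ i) * (l i * u $ i) = (cmod (u $ i))\<^sup>2 *\<^sub>R l i" for i
    unfolding scaleR_conv_of_real complex_norm_square by (simp add: mult_ac)
  then have "hermitian_inner u (diag_matrix l *v u) = ?m"
    by (simp add: hermitian_inner_def A mean_def)
  then have "rho (diag_matrix l) u = (\<Sum>i\<in>UNIV. (cmod (l i * u $ i - ?m * u $ i))\<^sup>2)"
    by (simp add: rho_def norm_squared_vec A)
  also have "\<dots> = variance l (\<chi> i. (cmod (u $ i))\<^sup>2)"
    unfolding variance_def left_diff_distrib[symmetric] by (simp add: norm_mult power_mult_distrib mult.commute flip: left_diff_distrib)
  finally show ?thesis .
qed

lemma proj_rho_diag_matrix: "proj_rho (diag_matrix l) L = variance l (weights L)"
proof -
  have "L \<in> weight_torus (weights L)" by (simp add: weight_torus_def)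
  then obtain u where u: "L = line u" "\<And>i. (cmod (u $ i))\<^sup>2 = weights L $ i"
    unfolding weight_torus_eq[OF prob_vector_weights] by blast
  then have "norm u = 1" using norm_of_moduli prob_vector_weights by blast
  then have "proj_rho (diag_matrix l) L = variance l (\<chi> i. (cmod (u $ i))\<^sup>2)"
    unfolding u(1) by (simp add: proj_rho_line rho_diag_matrix)
  also have "(\<chi> i. (cmod (u $ i))\<^sup>2) = weights L" by (simp add: u(2) vec_eq_iff)
  finally show ?thesis .
qed

text \<open>
  The parallel axis theorem. With the reference point \<open>c\<close> kept fixed, the first term is linear in the
  weights, and the second vanishes to second order where the mean equals \<open>c\<close>; this makes the
  derivative of the variance easy to compute.
\<close>

lemma variance_shift:
  assumes "prob_vector p"
  shows "variance l p = (\<Sum>i\<in>UNIV. p $ i * (cmod (l i - c))\<^sup>2) - (cmod (mean l p - c))\<^sup>2"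
proof -
  define \<mu> where "\<mu> = mean l p - c"
  have one: "(\<Sum>i\<in>UNIV. p $ i) = 1" using assms by (simp add: prob_vector_def)
  have "\<mu> = (\<Sum>i\<in>UNIV. p $ i *\<^sub>R (l i - c))"
    by (simp add: \<mu>_def mean_def scaleR_diff_right sum_subtractf one flip: scaleR_sum_left)
  then have \<mu>: "(\<Sum>i\<in>UNIV. p $ i * ((l i - c) \<bullet> \<mu>)) = \<mu> \<bullet> \<mu>"
    by (metis (no_types, lifting) inner_scaleR_left inner_sum_left sum.cong)
  have sq: "(cmod (l i - mean l p))\<^sup>2 = (cmod (l i - c))\<^sup>2 - 2 * ((l i - c) \<bullet> \<mu>) + \<mu> \<bullet> \<mu>" for i
  proof -
    have "l i - mean l p = (l i - c) - \<mu>" by (simp add: \<mu>_def)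
    then show ?thesis
      by (simp only: power2_norm_eq_inner inner_diff) (simp add: inner_commute)
  qed
  have "variance l p = (\<Sum>i\<in>UNIV. p $ i * (cmod (l i - c))\<^sup>2
      - 2 * (p $ i * ((l i - c) \<bullet> \<mu>)) + p $ i * (\<mu> \<bullet> \<mu>))"
    unfolding variance_def by (intro sum.cong refl) (simp only: sq, simp add: algebra_simps)
  with \<mu> show ?thesis
    by (simp add: sum.distrib sum_subtractf one power2_norm_eq_inner \<mu>_def
        flip: sum_distrib_left sum_distrib_right)
qed

text \<open>
  By \<open>variance_shift\<close> with the mean \<open>m\<close> at \<open>w\<close> as reference point, the function is
  \<open>v + G z / (z \<bullet> z) - M z \<bullet> M z\<close> with \<open>G\<close> quadratic and both \<open>G\<close> and \<open>M\<close> zero at \<open>w\<close>. So the last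
  term has derivative zero, and only the derivative of the numerator \<open>G\<close> contributes to that of the
  quotient.
\<close>

lemma proj_rho_has_derivative:
  fixes l :: "'n::finite \<Rightarrow> complex" and w :: "complex ^ 'n"
  assumes w: "w \<noteq> 0"
  defines "m \<equiv> mean l (weights (line w))" and "v \<equiv> variance l (weights (line w))"
  shows "((\<lambda>z. proj_rho (diag_matrix l) (line z)) has_derivative
      (\<lambda>h. 2 / (norm w)\<^sup>2 * (\<Sum>i\<in>UNIV. ((cmod (l i - m))\<^sup>2 - v) * (w $ i \<bullet> h $ i)))) (at w)"
proof -
  define k where "k i = (cmod (l i - m))\<^sup>2 - v" for i
  define G where "G z = (\<Sum>i\<in>UNIV. k i * (z $ i \<bullet> z $ i))" for z :: "complex ^ 'n"
  define M where "M z = (\<Sum>i\<in>UNIV. (z $ i \<bullet> z $ i) *\<^sub>R l i) /\<^sub>R (z \<bullet> z) - m" for z :: "complex ^ 'n"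
  have wt: "weights (line z) $ i = (z $ i \<bullet> z $ i) / (z \<bullet> z)" if "z \<noteq> 0" for z :: "complex ^ 'n" and i
    using that by (simp add: weights_line power2_norm_eq_inner)
  have M: "mean l (weights (line z)) - m = M z" if "z \<noteq> 0" for z
    using that by (simp add: mean_def wt M_def divide_inverse mult.commute scaleR_sum_right)
  have shift: "proj_rho (diag_matrix l) (line z) = v + G z / (z \<bullet> z) - M z \<bullet> M z" if "z \<noteq> 0" for z
  proof -
    have p: "prob_vector (weights (line z))" by (rule prob_vector_weights)
    have "G z / (z \<bullet> z) = (\<Sum>i\<in>UNIV. weights (line z) $ i * (cmod (l i - m))\<^sup>2)
        - (\<Sum>i\<in>UNIV. weights (line z) $ i) * v"
      using that unfolding G_def k_def sum_divide_distrib sum_distrib_right sum_subtractf[symmetric]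
      by (intro sum.cong refl) (simp add: wt algebra_simps diff_divide_distrib)
    then show ?thesis
      using p that by (simp add: proj_rho_diag_matrix variance_shift[OF p, of l m] M
          power2_norm_eq_inner prob_vector_def)
  qed
  have Mw: "M w = 0" using M[OF w] by (simp add: m_def)
  then have Gw: "G w = 0"
    using shift[OF w] w by (simp add: proj_rho_diag_matrix v_def)
  have "(G has_derivative (\<lambda>h. \<Sum>i\<in>UNIV. k i * (2 * (w $ i \<bullet> h $ i)))) (at w)"
    unfolding G_def
    by (auto intro!: derivative_eq_intros bounded_linear.has_derivative[OF bounded_linear_vec_nth]
        simp: inner_commute)
  then have dG: "((\<lambda>z. G z / (z \<bullet> z)) has_derivative
      (\<lambda>h. (\<Sum>i\<in>UNIV. k i * (2 * (w $ i \<bullet> h $ i))) / (w \<bullet> w))) (at w)"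
    using w Gw by (auto intro!: derivative_eq_intros simp: field_simps)
  obtain M' where "(M has_derivative M') (at w)"
  proof -
    have num: "((\<lambda>z. \<Sum>i\<in>UNIV. (z $ i \<bullet> z $ i) *\<^sub>R l i) has_derivative
        (\<lambda>h. \<Sum>i\<in>UNIV. (2 * (w $ i \<bullet> h $ i)) *\<^sub>R l i)) (at w)"
      by (auto intro!: derivative_eq_intros bounded_linear.has_derivative[OF bounded_linear_vec_nth]
          simp: inner_commute)
    have "((\<lambda>z. inverse (z \<bullet> z)) has_derivative
        (\<lambda>h. - (inverse (w \<bullet> w) * (2 * (w \<bullet> h)) * inverse (w \<bullet> w)))) (at w)"
      using w by (auto intro!: derivative_eq_intros simp: inner_commute)
    from has_derivative_diff[OF has_derivative_scaleR[OF this num] has_derivative_const[of m]]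
    show ?thesis using that unfolding M_def by blast
  qed
  then have dM: "((\<lambda>z. M z \<bullet> M z) has_derivative (\<lambda>h. 0)) (at w)"
    using Mw by (auto intro!: derivative_eq_intros)
  have "((\<lambda>z. v + G z / (z \<bullet> z) - M z \<bullet> M z) has_derivative
      (\<lambda>h. (\<Sum>i\<in>UNIV. k i * (2 * (w $ i \<bullet> h $ i))) / (w \<bullet> w))) (at w)"
    using has_derivative_diff[OF has_derivative_add[OF has_derivative_const[of v] dG] dM]
    by (simp only: add_0 diff_zero)
  then have "((\<lambda>z. proj_rho (diag_matrix l) (line z)) has_derivative
      (\<lambda>h. (\<Sum>i\<in>UNIV. k i * (2 * (w $ i \<bullet> h $ i))) / (w \<bullet> w))) (at w)"
    by (rule has_derivative_transform_within_open[of _ _ _ _ "- {0}"]) (use w shift in auto)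
  moreover have "(\<Sum>i\<in>UNIV. k i * (2 * (w $ i \<bullet> h $ i))) / (w \<bullet> w) =
      2 / (norm w)\<^sup>2 * (\<Sum>i\<in>UNIV. k i * (w $ i \<bullet> h $ i))" for h
    by (simp add: power2_norm_eq_inner sum_distrib_left sum_divide_distrib mult_ac)
  ultimately show ?thesis by (simp add: k_def)
qed

section \<open>The critical equation\<close>

text \<open>
  The critical equation of the residual, which by \<open>critical_set_eq\<close> concerns only the weights of a line.
\<close>

definition balanced :: "('n \<Rightarrow> complex) \<Rightarrow> real ^ 'n::finite \<Rightarrow> bool" where
  "balanced l p \<longleftrightarrow> prob_vector p \<and> (\<exists>r. \<forall>i. p $ i \<noteq> 0 \<longrightarrow> dist (l i) (mean l p) = r)"

lemma balanced_imp_variance: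
  assumes "balanced l p" "p $ i \<noteq> 0"
  shows "(cmod (l i - mean l p))\<^sup>2 = variance l p"
proof -
  from assms(1) obtain r where p: "prob_vector p" and r: "\<And>i. p $ i \<noteq> 0 \<Longrightarrow> dist (l i) (mean l p) = r"
    by (auto simp: balanced_def)
  have "variance l p = (\<Sum>i\<in>UNIV. p $ i * r\<^sup>2)"
    unfolding variance_def using r by (intro sum.cong refl) (auto simp: dist_norm)
  also have "\<dots> = r\<^sup>2" using p by (simp add: prob_vector_def flip: sum_distrib_right)
  finally show ?thesis using r[OF assms(2)] by (simp add: dist_norm)
qed

text \<open>
  In the affine chart \<open>w $ a = 1\<close> every coordinate except \<open>a\<close> may be varied freely, which gives the
  critical equation at these coordinates. At \<open>a\<close> itself it follows because the weighted sum of all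
  the equations is the definition of the variance.
\<close>

lemma critical_point_imp_balanced:
  fixes l :: "'n::finite \<Rightarrow> complex"
  assumes "critical_point (proj_rho (diag_matrix l)) L"
  shows "balanced l (weights L)"
proof -
  let ?p = "weights L"
  define k where "k i = (cmod (l i - mean l ?p))\<^sup>2 - variance l ?p" for i
  obtain v where v: "v \<noteq> 0" "L = line v" by (rule line_cases)
  then obtain a where a: "v $ a \<noteq> 0" by (auto simp: vec_eq_iff)
  define w where "w = inverse (v $ a) *s v"
  have w1: "w $ a = 1" using a by (simp add: w_def)
  then have w0: "w \<noteq> 0" by auto
  have wL: "line w = L" unfolding w_def v(2) by (rule line_smult) (use a v in auto)
  let ?F = "\<lambda>z. proj_rho (diag_matrix l) (line z)"
  let ?D = "\<lambda>h. 2 / (norm w)\<^sup>2 * (\<Sum>i\<in>UNIV. k i * (w $ i \<bullet> h $ i))"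
  have crit: "(?F has_derivative (\<lambda>_. 0)) (at w within {z. z $ a = 1})"
    using assms w1 wL unfolding critical_point_def by blast
  have deriv: "(?F has_derivative ?D) (at w)"
    using proj_rho_has_derivative[OF w0, of l] by (simp add: wL k_def)
  \<comment> \<open>The chart is a slice of the ambient space, so the two derivatives are compared along a straight
    line inside it.\<close>
  have D0: "?D h = 0" if h: "h $ a = 0" for h
  proof -
    let ?c = "\<lambda>t :: real. w + t *\<^sub>R h"
    have c: "(?c has_derivative (\<lambda>t. t *\<^sub>R h)) (at 0)"
      by (auto intro!: derivative_eq_intros)
    have "range ?c \<subseteq> {z. z $ a = 1}" using w1 h by auto
    then have "(?F has_derivative (\<lambda>_. 0)) (at (?c 0) within range ?c)"
      using has_derivative_subset[OF crit] by simp
    from has_derivative_in_compose[OF c this]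
    have "((\<lambda>t. ?F (?c t)) has_derivative (\<lambda>t. 0)) (at 0)" .
    moreover have "(?F has_derivative ?D) (at (?c 0))" using deriv by simp
    from has_derivative_compose[OF c this]
    have "((\<lambda>t. ?F (?c t)) has_derivative (\<lambda>t. ?D (t *\<^sub>R h))) (at 0)" .
    ultimately have "(\<lambda>t. 0) = (\<lambda>t. ?D (t *\<^sub>R h))" by (rule has_derivative_unique)
    from fun_cong[OF this, of 1] show ?thesis by simp
  qed
  have pw: "?p $ j = (cmod (w $ j))\<^sup>2 / (norm w)\<^sup>2" for j
    using weights_line[OF w0] wL by simp
  have k0: "?p $ j * k j = 0" if "j \<noteq> a" for j
  proof -
    have "?D (axis j (w $ j)) = 0" using that by (intro D0) (simp add: axis_def)
    moreover have "(\<Sum>i\<in>UNIV. k i * (w $ i \<bullet> axis j (w $ j) $ i)) = k j * (w $ j \<bullet> w $ j)"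
    proof -
      have "k i * (w $ i \<bullet> axis j (w $ j) $ i) = (if i = j then k j * (w $ j \<bullet> w $ j) else 0)" for i
        by (simp add: axis_def)
      then show ?thesis by simp
    qed
    ultimately have "k j * (w $ j \<bullet> w $ j) = 0" using w0 by (simp del: inner_eq_zero_iff)
    then show ?thesis by (auto simp: pw)
  qed
  have "(\<Sum>i\<in>UNIV. ?p $ i * k i) = 0"
    using prob_vector_weights[of L] unfolding prob_vector_def
    by (simp add: k_def right_diff_distrib sum_subtractf variance_def flip: sum_distrib_right)
  moreover have "(\<Sum>i\<in>UNIV - {a}. ?p $ i * k i) = 0"
    using k0 by (intro sum.neutral) blast
  then have "(\<Sum>i\<in>UNIV. ?p $ i * k i) = ?p $ a * k a"
    by (subst sum.remove[of _ a]) simp_all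
  ultimately have "?p $ j * k j = 0" for j using k0 by (cases "j = a") auto
  then have "?p $ i \<noteq> 0 \<Longrightarrow> dist (l i) (mean l ?p) = sqrt (variance l ?p)" for i
    by (auto simp: k_def dist_norm intro!: real_sqrt_unique[symmetric])
  then show ?thesis using prob_vector_weights unfolding balanced_def by blast
qed

text \<open>
  Here every summand of the ambient derivative vanishes: either the weight is zero, and with it the
  coordinate of \<open>w\<close>, or the critical equation holds.
\<close>

lemma balanced_imp_critical_point:
  assumes "balanced l (weights L)"
  shows "critical_point (proj_rho (diag_matrix l)) L"
  unfolding critical_point_def
proof (intro allI impI, elim conjE)
  fix a w
  assume "w $ a = 1" and L: "line w = L"
  then have w: "w \<noteq> 0" by auto
  have "((cmod (l i - mean l (weights L)))\<^sup>2 - variance l (weights L)) * (w $ i \<bullet> h $ i) = 0" for i h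
  proof (cases "w $ i = 0")
    case False
    then have "weights L $ i \<noteq> 0" using w by (auto simp: weights_line simp flip: L)
    then show ?thesis using balanced_imp_variance[OF assms] by simp
  qed simp
  then show "((\<lambda>z. proj_rho (diag_matrix l) (line z)) has_derivative (\<lambda>_. 0))
      (at w within {z. z $ a = 1})"
    using has_derivative_at_withinI[OF proj_rho_has_derivative[OF w, of l]]
    unfolding L by (simp only: sum.neutral_const mult_zero_right)
qed

lemma critical_set_eq:
  "critical_set (proj_rho (diag_matrix l)) = {L. balanced l (weights L)}"
  using critical_point_imp_balanced balanced_imp_critical_point
  by (auto simp: critical_set_def)

section \<open>Circumcenters and acute triangles\<close>

lemma vertex_angle_acute_iff:
  assumes "a \<noteq> b" "c \<noteq> b"
  shows "vertex_angle a b c < pi / 2 \<longleftrightarrow> 0 < (a - b) \<bullet> (c - b)"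
proof -
  let ?x = "((a - b) \<bullet> (c - b)) / (norm (a - b) * norm (c - b))"
  have pos: "0 < norm (a - b) * norm (c - b)" using assms by simp
  then have "\<bar>?x\<bar> \<le> 1"
    using Cauchy_Schwarz_ineq2[of "a - b" "c - b"] by (simp add: abs_mult)
  then have "vertex_angle a b c < pi / 2 \<longleftrightarrow> 0 < ?x"
    using arccos_less_mono[of ?x 0] by (simp add: vertex_angle_def)
  also have "\<dots> \<longleftrightarrow> 0 < (a - b) \<bullet> (c - b)" using pos by (simp add: zero_less_divide_iff)
  finally show ?thesis .
qed

lemma dist_eq_iff_inner:
  fixes a b m :: "'a::real_inner"
  shows "dist a m = dist b m \<longleftrightarrow> (a - b) \<bullet> (a - b) = 2 * ((a - b) \<bullet> (m - b))"
proof -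
  have "dist a m = dist b m \<longleftrightarrow> (norm (a - m))\<^sup>2 = (norm (b - m))\<^sup>2"
    by (simp add: dist_norm)
  then show ?thesis
    unfolding power2_norm_eq_inner by (simp add: inner_diff inner_commute algebra_simps)
qed

lemma barycentric_diff:
  fixes a b c :: "'a::real_vector" and x y z :: real
  assumes "x + y + z = 1"
  shows "(x *\<^sub>R a + y *\<^sub>R b + z *\<^sub>R c) - b = x *\<^sub>R (a - b) + z *\<^sub>R (c - b)"
proof -
  have y: "y = 1 - x - z" using assms by simp
  show ?thesis unfolding y by (simp add: algebra_simps)
qed

text \<open>
  With \<open>X = a - b\<close> and \<open>Y = c - b\<close>, equidistance reads \<open>(1 - 2 x) (X \<bullet> X) = 2 z (X \<bullet> Y)\<close> and
  \<open>(1 - 2 z) (Y \<bullet> Y) = 2 x (X \<bullet> Y)\<close>. If the angle were not acute, both \<open>x\<close> and \<open>z\<close> would be at least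
  \<open>1 / 2\<close>, leaving nothing for \<open>y\<close>.
\<close>

lemma angle_acute_if_circumcenter_interior:
  fixes a b c m :: "'a::real_inner" and x y z :: real
  assumes "a \<noteq> b" "c \<noteq> b" and pos: "0 < x" "0 < y" "0 < z" and sum: "x + y + z = 1"
    and m: "x *\<^sub>R a + y *\<^sub>R b + z *\<^sub>R c = m"
    and dist: "dist a m = dist b m" "dist c m = dist b m"
  shows "0 < (a - b) \<bullet> (c - b)"
proof (rule ccontr)
  define X where "X = a - b"
  define Y where "Y = c - b"
  assume "\<not> 0 < (a - b) \<bullet> (c - b)"
  then have neg: "X \<bullet> Y \<le> 0" by (simp add: X_def Y_def)
  have XY: "0 < X \<bullet> X" "0 < Y \<bullet> Y" using assms by (auto simp: X_def Y_def)
  have mb: "m - b = x *\<^sub>R X + z *\<^sub>R Y"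
    using barycentric_diff[OF sum, of a b c] m by (simp add: X_def Y_def)
  have "(1 - 2 * x) * (X \<bullet> X) = 2 * z * (X \<bullet> Y)" "(1 - 2 * z) * (Y \<bullet> Y) = 2 * x * (X \<bullet> Y)"
    using dist unfolding dist_eq_iff_inner mb X_def[symmetric] Y_def[symmetric]
    by (simp_all add: inner_add_right inner_commute algebra_simps)
  then have "(1 - 2 * x) * (X \<bullet> X) \<le> 0" "(1 - 2 * z) * (Y \<bullet> Y) \<le> 0"
    using neg pos by (simp_all add: mult_nonneg_nonpos)
  then have "1 \<le> 2 * x" "1 \<le> 2 * z" using XY by (simp_all add: mult_le_0_iff)
  then show False using pos sum by linarith
qed

text \<open>
  The barycentric coordinates of the circumcenter are proportional to \<open>A (B + C)\<close>, \<open>B (C + A)\<close> and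
  \<open>C (A + B)\<close>, where \<open>A\<close>, \<open>B\<close> and \<open>C\<close> are the inner products of the sides at the three vertices.
  These are the classical coordinates \<open>\<alpha>\<^sup>2 (\<beta>\<^sup>2 + \<gamma>\<^sup>2 - \<alpha>\<^sup>2)\<close> in terms of the side lengths, since
  \<open>\<alpha>\<^sup>2 = B + C\<close> and \<open>\<beta>\<^sup>2 + \<gamma>\<^sup>2 - \<alpha>\<^sup>2 = 2 A\<close>.
\<close>

lemma acute_imp_circumcenter_interior:
  fixes a b c :: "'a::real_inner"
  assumes "0 < (b - a) \<bullet> (c - a)" "0 < (a - b) \<bullet> (c - b)" "0 < (a - c) \<bullet> (b - c)"
  obtains x y z :: real where "0 < x" "0 < y" "0 < z" "x + y + z = 1"
    "dist a (x *\<^sub>R a + y *\<^sub>R b + z *\<^sub>R c) = dist b (x *\<^sub>R a + y *\<^sub>R b + z *\<^sub>R c)"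
    "dist c (x *\<^sub>R a + y *\<^sub>R b + z *\<^sub>R c) = dist b (x *\<^sub>R a + y *\<^sub>R b + z *\<^sub>R c)"
proof -
  define X where "X = a - b"
  define Y where "Y = c - b"
  define A where "A = (b - a) \<bullet> (c - a)"
  define B where "B = (a - b) \<bullet> (c - b)"
  define C where "C = (a - c) \<bullet> (b - c)"
  define K where "K = A * B + B * C + C * A"
  have pos: "0 < A" "0 < B" "0 < C" using assms by (simp_all add: A_def B_def C_def)
  then have K: "0 < K" by (simp add: K_def add_pos_pos)
  have XX: "X \<bullet> X = A + B" and YY: "Y \<bullet> Y = B + C" and XY: "X \<bullet> Y = B"
    by (simp_all add: X_def Y_def A_def B_def C_def inner_diff inner_commute algebra_simps)
  define x where "x = A * (B + C) / (2 * K)"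
  define y where "y = B * (C + A) / (2 * K)"
  define z where "z = C * (A + B) / (2 * K)"
  have xyz: "0 < x" "0 < y" "0 < z" using pos K by (simp_all add: x_def y_def z_def)
  have "A * (B + C) + B * (C + A) + C * (A + B) = 2 * K"
    by (simp add: K_def algebra_simps)
  then have sum: "x + y + z = 1"
    using K by (simp add: x_def y_def z_def flip: add_divide_distrib)
  have mb: "(x *\<^sub>R a + y *\<^sub>R b + z *\<^sub>R c) - b = x *\<^sub>R X + z *\<^sub>R Y"
    unfolding X_def Y_def by (rule barycentric_diff[OF sum])
  have 1: "A * (B + C) * (A + B) + C * (A + B) * B = (A + B) * K"
    and 2: "A * (B + C) * B + C * (A + B) * (B + C) = (B + C) * K"
    by (simp_all add: K_def algebra_simps)
  have e1: "2 * (x * (A + B) + z * B) = A + B"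
  proof -
    have "2 * (x * (A + B) + z * B) = (A * (B + C) * (A + B) + C * (A + B) * B) / K"
      using K by (simp add: x_def z_def field_simps)
    then show ?thesis using K by (simp add: 1)
  qed
  have e2: "2 * (x * B + z * (B + C)) = B + C"
  proof -
    have "2 * (x * B + z * (B + C)) = (A * (B + C) * B + C * (A + B) * (B + C)) / K"
      using K by (simp add: x_def z_def field_simps)
    then show ?thesis using K by (simp add: 2)
  qed
  have "dist a (x *\<^sub>R a + y *\<^sub>R b + z *\<^sub>R c) = dist b (x *\<^sub>R a + y *\<^sub>R b + z *\<^sub>R c)"
    unfolding dist_eq_iff_inner mb X_def[symmetric] using e1
    by (simp add: inner_add_right XX XY)
  moreover have "dist c (x *\<^sub>R a + y *\<^sub>R b + z *\<^sub>R c) = dist b (x *\<^sub>R a + y *\<^sub>R b + z *\<^sub>R c)"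
    unfolding dist_eq_iff_inner mb Y_def[symmetric] using e2
    by (simp add: inner_add_right YY XY inner_commute[of Y X])
  ultimately show thesis using that[of x y z] xyz sum by blast
qed

lemma independent_sides:
  fixes a b c :: complex
  assumes "\<not> collinear {a, b, c}" and "s *\<^sub>R (a - b) + t *\<^sub>R (c - b) = 0"
  shows "s = 0 \<and> t = 0"
proof -
  have nc: "\<not> collinear {0, a - b, c - b}"
    using assms(1) collinear_3[of a b c] unfolding NO_MATCH_def by simp
  have "t = 0"
  proof (rule ccontr)
    assume "t \<noteq> 0"
    have "t *\<^sub>R (c - b) = (- s) *\<^sub>R (a - b)"
      using assms(2) by (simp add: eq_neg_iff_add_eq_0 add.commute)
    then have "(1 / t) *\<^sub>R (t *\<^sub>R (c - b)) = (1 / t) *\<^sub>R ((- s) *\<^sub>R (a - b))" by simp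
    then have "c - b = (- s / t) *\<^sub>R (a - b)" using \<open>t \<noteq> 0\<close> by simp
    then show False using nc unfolding collinear_lemma by blast
  qed
  moreover from this have "s = 0"
    using assms(2) nc by (auto simp: collinear_lemma)
  ultimately show ?thesis by blast
qed

text \<open>
  The difference of two circumcenters is orthogonal to two independent sides, which is impossible in
  the plane unless it is zero.
\<close>

lemma circumcenter_eqI:
  assumes nc: "\<not> collinear {a, b, c}" and m: "{a, b, c} \<subseteq> sphere m r"
  shows "circumcenter {a, b, c} = m"
  unfolding circumcenter_def
proof (rule the_equality)
  show "\<exists>r. {a, b, c} \<subseteq> sphere m r" using m by blast
  fix z
  assume "\<exists>r. {a, b, c} \<subseteq> sphere z r"
  then have "dist a z = dist b z" "dist c z = dist b z" by (auto simp: dist_commute)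
  moreover have "dist a m = dist b m" "dist c m = dist b m" using m by (auto simp: dist_commute)
  ultimately have orth: "(a - b) \<bullet> (z - m) = 0" "(c - b) \<bullet> (z - m) = 0"
    unfolding dist_eq_iff_inner by (simp_all add: inner_diff_right)
  show "z = m"
  proof (rule ccontr)
    assume "z \<noteq> m"
    define X Y w where "X = a - b" and "Y = c - b" and "w = z - m"
    have w: "Re X * Re w + Im X * Im w = 0" "Re Y * Re w + Im Y * Im w = 0" "w \<noteq> 0"
      using orth \<open>z \<noteq> m\<close> by (simp_all add: X_def Y_def w_def inner_complex_def)
    \<comment> \<open>The determinant of the two sides, which vanishes since both are orthogonal to \<open>w\<close>.\<close>
    define D where "D = Re X * Im Y - Im X * Re Y"
    have "D * Re w = Im Y * (Re X * Re w + Im X * Im w) - Im X * (Re Y * Re w + Im Y * Im w)"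
      "D * Im w = Re X * (Re Y * Re w + Im Y * Im w) - Re Y * (Re X * Re w + Im X * Im w)"
      by (simp_all add: D_def algebra_simps)
    then have "D = 0" using w by (auto simp: complex_eq_iff)
    \<comment> \<open>When \<open>D = 0\<close>, this is a linear relation between the sides.\<close>
    moreover have "(Y \<bullet> Y) *\<^sub>R X + (- (X \<bullet> Y)) *\<^sub>R Y = Complex (Im Y * D) (- Re Y * D)"
      by (simp add: complex_eq_iff inner_complex_def D_def algebra_simps)
    ultimately have "Y \<bullet> Y = 0"
      using independent_sides[OF nc, of "Y \<bullet> Y" "- (X \<bullet> Y)"]
      by (simp add: X_def Y_def Complex_eq_0)
    then show False using nc by (simp add: Y_def)
  qed
qed

section \<open>The balanced weights\<close>

abbreviation support :: "real ^ 'n \<Rightarrow> 'n set" where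
  "support p \<equiv> {i. p $ i \<noteq> 0}"

lemma sum_over_support:
  fixes p :: "real ^ 'n::finite" and f :: "'n \<Rightarrow> 'a::comm_monoid_add"
  assumes "support p \<subseteq> T" "\<And>i. p $ i = 0 \<Longrightarrow> f i = 0"
  shows "(\<Sum>i\<in>UNIV. f i) = (\<Sum>i\<in>T. f i)"
  using assms by (intro sum.mono_neutral_right) auto

lemma
  assumes "support p \<subseteq> T"
  shows mass_over_support: "(\<Sum>i\<in>UNIV. p $ i) = (\<Sum>i\<in>T. p $ i)"
    and mean_over_support: "mean l p = (\<Sum>i\<in>T. p $ i *\<^sub>R l i)"
  unfolding mean_def by (intro sum_over_support[OF assms]; simp)+

definition pair_weights :: "'n set \<Rightarrow> real ^ 'n" where
  "pair_weights P = (\<chi> i. if i \<in> P then 1 / 2 else 0)"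

lemma balanced_axis: "balanced l (axis i 1)"
proof -
  have s: "support (axis i 1) \<subseteq> {i}" by (auto simp: axis_def)
  show ?thesis
    unfolding balanced_def prob_vector_def mass_over_support[OF s] mean_over_support[OF s]
    by (auto simp: axis_def)
qed

lemma support_pair_weights: "support (pair_weights P) = P"
  by (auto simp: pair_weights_def)

lemma balanced_pair_weights:
  assumes "card P = 2"
  shows "balanced l (pair_weights P)"
proof -
  obtain i j where P: "P = {i, j}" "i \<noteq> j" using assms by (auto simp: card_2_iff)
  have s: "support (pair_weights P) \<subseteq> P" by (simp add: support_pair_weights)
  have "prob_vector (pair_weights P :: real ^ 'a)"
    unfolding prob_vector_def mass_over_support[OF s] using P by (simp add: pair_weights_def)
  moreover have mean: "mean l (pair_weights P) = midpoint (l i) (l j)"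
    using P unfolding mean_over_support[OF s]
    by (simp add: pair_weights_def midpoint_def scaleR_add_right)
  have "dist (l k) (mean l (pair_weights P)) = dist (l i) (l j) / 2"
    if "pair_weights P $ k \<noteq> 0" for k
    using that P unfolding mean by (auto simp: pair_weights_def dist_midpoint split: if_splits)
  ultimately show ?thesis unfolding balanced_def by blast
qed

lemma balanced_support_1:
  assumes "balanced l p" "support p = {i}"
  shows "p = axis i 1"
proof -
  have "p $ i = 1"
    using assms mass_over_support[of p "{i}"] by (simp add: balanced_def prob_vector_def)
  then show ?thesis using assms(2) by (auto simp: vec_eq_iff axis_def)
qed

lemma balanced_support_2:
  assumes l: "inj l" and p: "balanced l p" "card (support p) = 2"
  shows "p = pair_weights (support p)"
proof -
  obtain i j where S: "support p = {i, j}" "i \<noteq> j" using p(2) by (auto simp: card_2_iff)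
  from p(1) obtain r where "\<And>i. p $ i \<noteq> 0 \<Longrightarrow> dist (l i) (mean l p) = r"
    by (auto simp: balanced_def)
  then have dist: "dist (l i) (mean l p) = dist (l j) (mean l p)" using S by auto
  have pos: "0 \<le> p $ i" "0 \<le> p $ j" and sum: "p $ i + p $ j = 1"
    using p(1) S mass_over_support[of p "{i, j}"] by (simp_all add: balanced_def prob_vector_def)
  have "mean l p - l j = (p $ i *\<^sub>R l i + p $ j *\<^sub>R l j + 0 *\<^sub>R l j) - l j"
    using S mean_over_support[of p "{i, j}" l] by simp
  also have "\<dots> = p $ i *\<^sub>R (l i - l j)"
    by (subst barycentric_diff) (use sum in simp_all)
  finally have mean: "mean l p - l j = p $ i *\<^sub>R (l i - l j)" .
  have "(1 - 2 * p $ i) * ((l i - l j) \<bullet> (l i - l j)) = 0"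
    using dist unfolding dist_eq_iff_inner mean by (simp add: left_diff_distrib)
  then have "p $ i = 1 / 2" using l S(2) by (simp add: inj_eq)
  moreover from this have "p $ j = 1 / 2" using sum by simp
  ultimately show ?thesis using S by (auto simp: vec_eq_iff pair_weights_def)
qed

lemma balanced_support_3:
  assumes l: "inj l" and p: "balanced l p" "card (support p) = 3"
    and nc: "\<not> collinear (l ` support p)"
  shows "acute_triangle (l ` support p)" "mean l p = circumcenter (l ` support p)"
proof -
  let ?S = "support p"
  from p(1) obtain r where r: "\<And>i. p $ i \<noteq> 0 \<Longrightarrow> dist (l i) (mean l p) = r"
    and prob: "prob_vector p"
    by (auto simp: balanced_def)
  have card: "card (l ` ?S) = 3" using p(2) l by (simp add: card_image inj_on_subset)
  have angle: "vertex_angle a b c < pi / 2" if abc: "l ` ?S = {a, b, c}" for a b c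
  proof -
    have dist3: "a \<noteq> b" "a \<noteq> c" "b \<noteq> c"
      using card abc by (auto simp: card_insert_if split: if_splits)
    have "a \<in> l ` ?S" "b \<in> l ` ?S" "c \<in> l ` ?S" using abc by auto
    then obtain i j k where ijk: "a = l i" "b = l j" "c = l k" "p $ i \<noteq> 0" "p $ j \<noteq> 0" "p $ k \<noteq> 0"
      by blast
    then have "l ` ?S = l ` {i, j, k}" using abc by simp
    then have S: "?S = {i, j, k}" using l by (simp only: inj_image_eq_iff)
    have ne: "i \<noteq> j" "i \<noteq> k" "j \<noteq> k" using ijk dist3 by auto
    have "p $ i + p $ j + p $ k = 1"
      using prob S mass_over_support[of p "{i, j, k}"] ne by (simp add: prob_vector_def)
    moreover have "p $ i *\<^sub>R a + p $ j *\<^sub>R b + p $ k *\<^sub>R c = mean l p"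
      using S mean_over_support[of p "{i, j, k}" l] ne by (simp add: ijk)
    moreover have "0 < p $ i" "0 < p $ j" "0 < p $ k"
      using prob ijk by (simp_all add: prob_vector_def less_le)
    ultimately have "0 < (a - b) \<bullet> (c - b)"
      using r ijk dist3
      by (intro angle_acute_if_circumcenter_interior[of a b c "p $ i" "p $ j" "p $ k" "mean l p"]) auto
    then show ?thesis using dist3 vertex_angle_acute_iff[of a b c] by blast
  qed
  then show "acute_triangle (l ` ?S)"
    using card nc by (simp add: acute_triangle_def nondegenerate_triangle_def)
  obtain a b c where abc: "l ` ?S = {a, b, c}" using card by (auto simp: card_3_iff)
  have "l ` ?S \<subseteq> sphere (mean l p) r" using r by (auto simp: dist_commute)
  then show "mean l p = circumcenter (l ` ?S)"
    using nc circumcenter_eqI[of a b c "mean l p" r] unfolding abc by simp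
qed

lemma acute_triangle_balanced:
  fixes l :: "'n::finite \<Rightarrow> complex"
  assumes l: "inj l" and T: "card T = 3" "acute_triangle (l ` T)"
  shows "\<exists>p. balanced l p \<and> support p = T"
proof -
  obtain i j k where ijk: "T = {i, j, k}" "i \<noteq> j" "i \<noteq> k" "j \<noteq> k"
    using T(1) by (auto simp: card_3_iff)
  have ne: "l i \<noteq> l j" "l i \<noteq> l k" "l j \<noteq> l k" using l ijk by (auto simp: inj_eq)
  have *: "\<And>a b c. l ` T = {a, b, c} \<Longrightarrow> vertex_angle a b c < pi / 2"
    using T(2) by (auto simp: acute_triangle_def)
  have "vertex_angle (l j) (l i) (l k) < pi / 2" by (rule *) (auto simp: ijk)
  moreover have "vertex_angle (l i) (l j) (l k) < pi / 2" by (rule *) (auto simp: ijk)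
  moreover have "vertex_angle (l i) (l k) (l j) < pi / 2" by (rule *) (auto simp: ijk)
  ultimately have "0 < (l j - l i) \<bullet> (l k - l i)" "0 < (l i - l j) \<bullet> (l k - l j)"
    "0 < (l i - l k) \<bullet> (l j - l k)"
    using ne vertex_angle_acute_iff[of "l j" "l i" "l k"] vertex_angle_acute_iff[of "l i" "l j" "l k"]
      vertex_angle_acute_iff[of "l i" "l k" "l j"] by metis+
  then obtain x y z where xyz: "0 < x" "0 < y" "0 < z" "x + y + z = 1" and
    dist: "dist (l i) (x *\<^sub>R l i + y *\<^sub>R l j + z *\<^sub>R l k) = dist (l j) (x *\<^sub>R l i + y *\<^sub>R l j + z *\<^sub>R l k)"
    "dist (l k) (x *\<^sub>R l i + y *\<^sub>R l j + z *\<^sub>R l k) = dist (l j) (x *\<^sub>R l i + y *\<^sub>R l j + z *\<^sub>R l k)"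
    by (rule acute_imp_circumcenter_interior)
  define p :: "real ^ 'n"
    where "p = (\<chi> n. if n = i then x else if n = j then y else if n = k then z else 0)"
  have S: "support p = T" using xyz ijk by (auto simp: p_def)
  have ps: "p $ i = x" "p $ j = y" "p $ k = z" using ijk by (simp_all add: p_def)
  have "prob_vector p"
    unfolding prob_vector_def mass_over_support[OF equalityD1[OF S]]
    using ijk xyz by (auto simp: ps) (auto simp: p_def)
  moreover have m: "mean l p = x *\<^sub>R l i + y *\<^sub>R l j + z *\<^sub>R l k"
    unfolding mean_over_support[OF equalityD1[OF S]] using ijk by (simp add: ps)
  have "dist (l n) (mean l p) = dist (l j) (mean l p)" if "p $ n \<noteq> 0" for n
    using that S dist unfolding m by (auto simp: ijk)
  ultimately have "balanced l p" unfolding balanced_def by blast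
  then show ?thesis using S by blast
qed

lemma barycentric_unique:
  assumes l: "inj l" and T: "card T = 3" "\<not> collinear (l ` T)"
    and p: "prob_vector p" "support p \<subseteq> T" and q: "prob_vector q" "support q \<subseteq> T"
    and mean: "mean l p = mean l q"
  shows "p = q"
proof -
  obtain i j k where ijk: "T = {i, j, k}" "i \<noteq> j" "i \<noteq> k" "j \<noteq> k"
    using T(1) by (auto simp: card_3_iff)
  have sum: "p $ i + p $ j + p $ k = 1" "q $ i + q $ j + q $ k = 1"
    using p q mass_over_support[OF p(2)] mass_over_support[OF q(2)] ijk
    by (simp_all add: prob_vector_def)
  have p': "p $ i *\<^sub>R (l i - l j) + p $ k *\<^sub>R (l k - l j) = mean l p - l j"
    and q': "q $ i *\<^sub>R (l i - l j) + q $ k *\<^sub>R (l k - l j) = mean l q - l j"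
    using ijk by (simp_all add: mean_over_support[OF p(2)] mean_over_support[OF q(2)]
        flip: barycentric_diff[OF sum(1)] barycentric_diff[OF sum(2)])
  have "(p $ i - q $ i) *\<^sub>R (l i - l j) + (p $ k - q $ k) *\<^sub>R (l k - l j)
      = (mean l p - l j) - (mean l q - l j)"
    unfolding p'[symmetric] q'[symmetric] by (simp add: scaleR_diff_left)
  then have "(p $ i - q $ i) *\<^sub>R (l i - l j) + (p $ k - q $ k) *\<^sub>R (l k - l j) = 0"
    by (simp add: mean)
  then have "p $ i - q $ i = 0 \<and> p $ k - q $ k = 0"
    using T(2) by (intro independent_sides) (simp_all add: ijk)
  then have "p $ n = q $ n" if "n \<in> T" for n using sum that ijk by auto
  moreover have "p $ n = q $ n" if "n \<notin> T" for n
  proof -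
    have "p $ n = 0" "q $ n = 0" using that p(2) q(2) by blast+
    then show ?thesis by simp
  qed
  ultimately show ?thesis by (metis vec_eq_iff)
qed

text \<open>
  For an acute triangle, the barycentric coordinates of its circumcenter, extended by zero. The
  choice is unique there by \<open>barycentric_unique\<close>, since balanced weights with this support have the
  circumcenter as mean.
\<close>

definition circumcenter_weights :: "('n::finite \<Rightarrow> complex) \<Rightarrow> 'n set \<Rightarrow> real ^ 'n" where
  "circumcenter_weights l T = (SOME p. balanced l p \<and> support p = T)"

lemma
  fixes l :: "'n::finite \<Rightarrow> complex"
  assumes l: "inj l" and T: "card T = 3" "acute_triangle (l ` T)"
  shows balanced_circumcenter_weights: "balanced l (circumcenter_weights l T)"
    and support_circumcenter_weights: "support (circumcenter_weights l T) = T"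
    and mean_circumcenter_weights: "mean l (circumcenter_weights l T) = circumcenter (l ` T)"
proof -
  let ?p = "circumcenter_weights l T"
  have *: "balanced l ?p \<and> support ?p = T"
    unfolding circumcenter_weights_def using acute_triangle_balanced[OF assms] by (rule someI_ex)
  then show "balanced l ?p" "support ?p = T" by auto
  show "mean l ?p = circumcenter (l ` T)"
    using balanced_support_3(2)[OF l, of ?p] * T
    by (simp add: acute_triangle_def nondegenerate_triangle_def)
qed

lemma balanced_card_support:
  assumes l: "inj l" and gp: "general_position (range l)" and p: "balanced l p"
  shows "card (support p) \<in> {1, 2, 3}"
proof -
  from p obtain r where prob: "prob_vector p"
    and r: "\<And>i. p $ i \<noteq> 0 \<Longrightarrow> dist (l i) (mean l p) = r"
    by (auto simp: balanced_def)
  have "support p \<noteq> {}"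
  proof
    assume "support p = {}"
    then have "p $ i = 0" for i by auto
    then show False using prob by (simp add: prob_vector_def)
  qed
  then have "0 < card (support p)" by (simp add: card_gt_0_iff)
  moreover have "\<not> 4 \<le> card (support p)"
  proof
    assume "4 \<le> card (support p)"
    then obtain T where T: "T \<subseteq> support p" "card T = 4" by (meson obtain_subset_with_card_n)
    then obtain i j where ij: "i \<in> T" "j \<in> T" "i \<noteq> j"
      using card_le_Suc0_iff_eq[of T] by auto
    have "0 < r"
    proof -
      have "p $ i \<noteq> 0" "p $ j \<noteq> 0" using T(1) ij by auto
      then have "dist (l i) (l j) \<le> r + r"
        using r[of i] r[of j] dist_triangle2[of "l i" "l j" "mean l p"] by simp
      moreover have "0 < dist (l i) (l j)" using l ij by (simp add: inj_eq)
      ultimately show ?thesis by linarith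
    qed
    moreover have "l ` T \<subseteq> sphere (mean l p) r" using r T(1) by (auto simp: dist_commute)
    ultimately have "concyclic (l ` T)" unfolding concyclic_def by blast
    moreover have "card (l ` T) = 4" using T l by (simp add: card_image inj_on_subset)
    moreover have "\<forall>T\<subseteq>range l. card T = 4 \<longrightarrow> \<not> concyclic T"
      using gp by (simp add: general_position_def)
    ultimately show False by (meson image_mono subset_UNIV)
  qed
  ultimately show ?thesis by auto
qed

text \<open>
  General position bounds the support by three points; each support size is then settled by its own
  lemma above.
\<close>

lemma balanced_iff:
  assumes l: "inj l" and gp: "general_position (range l)"
  shows "balanced l p \<longleftrightarrow> p \<in> range (\<lambda>i. axis i 1) \<union> pair_weights ` {P. card P = 2} \<union>
    circumcenter_weights l ` {T. card T = 3 \<and> acute_triangle (l ` T)}"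
proof
  assume p: "balanced l p"
  from balanced_card_support[OF l gp p]
  consider "card (support p) = 1" | "card (support p) = 2" | "card (support p) = 3" by auto
  then show "p \<in> range (\<lambda>i. axis i 1) \<union> pair_weights ` {P. card P = 2} \<union>
    circumcenter_weights l ` {T. card T = 3 \<and> acute_triangle (l ` T)}"
  proof cases
    case 1
    then obtain i where "support p = {i}" by (auto simp: card_1_singleton_iff)
    then show ?thesis using balanced_support_1[OF p] by auto
  next
    case 2
    then show ?thesis using balanced_support_2[OF l p] by blast
  next
    case 3
    let ?T = "support p"
    have "card (l ` ?T) = 3" using 3 l by (simp add: card_image inj_on_subset)
    moreover have "\<forall>T\<subseteq>range l. card T = 3 \<longrightarrow> \<not> collinear T"
      using gp by (simp add: general_position_def)
    ultimately have nc: "\<not> collinear (l ` ?T)" by (meson image_mono subset_UNIV)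
    note acute = balanced_support_3[OF l p 3 nc]
    have "p = circumcenter_weights l ?T"
    proof (rule barycentric_unique[OF l 3 nc])
      show "prob_vector p" "prob_vector (circumcenter_weights l ?T)"
        using p balanced_circumcenter_weights[OF l 3 acute(1)] by (simp_all add: balanced_def)
      show "support (circumcenter_weights l ?T) \<subseteq> ?T"
        using support_circumcenter_weights[OF l 3 acute(1)] by simp
      show "mean l p = mean l (circumcenter_weights l ?T)"
        using acute mean_circumcenter_weights[OF l 3 acute(1)] by simp
    qed simp
    then show ?thesis using 3 acute(1) by blast
  qed
next
  assume "p \<in> range (\<lambda>i. axis i 1) \<union> pair_weights ` {P. card P = 2} \<union>
    circumcenter_weights l ` {T. card T = 3 \<and> acute_triangle (l ` T)}"
  then show "balanced l p"
    using balanced_axis balanced_pair_weights balanced_circumcenter_weights[OF l] by auto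
qed

section \<open>The critical components as weight tori\<close>

lemma balanced_prob: "balanced l p \<Longrightarrow> prob_vector p"
  by (simp add: balanced_def)

lemma weight_torus_axis: "weight_torus (axis i 1) = {eigenline i}"
proof -
  have p: "prob_vector (axis i 1)" by (rule balanced_prob[OF balanced_axis])
  have "L = eigenline i" if L: "L \<in> weight_torus (axis i 1)" for L
  proof -
    obtain u where u: "L = line u" "\<And>j. (cmod (u $ j))\<^sup>2 = (axis i 1 :: real ^ 'a) $ j"
      using L unfolding weight_torus_eq[OF p] by blast
    have "u $ i \<noteq> 0" using u(2)[of i] by auto
    moreover have "u $ j = 0" if "j \<noteq> i" for j using u(2)[of j] that by (simp add: axis_def)
    then have "u = u $ i *s axis i 1" by (simp add: vec_eq_iff axis_def)
    ultimately show ?thesis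
      using line_smult[of "u $ i" "axis i 1"] by (simp add: u(1) eigenline_def)
  qed
  then show ?thesis using weight_torus_nonempty[OF p] by blast
qed

lemma weight_torus_pair_weights:
  assumes "card P = 2"
  shows "weight_torus (pair_weights P) = pair_circle P"
proof -
  have p: "prob_vector (pair_weights P)" by (rule balanced_prob[OF balanced_pair_weights[OF assms]])
  have "(\<forall>i. (cmod (u $ i))\<^sup>2 = pair_weights P $ i) \<longleftrightarrow>
      norm u = 1 \<and> (\<forall>i\<in>P. (cmod (u $ i))\<^sup>2 = 1 / 2) \<and> (\<forall>k. k \<notin> P \<longrightarrow> u $ k = 0)" for u
    using norm_of_moduli[OF p, of u] by (auto simp: pair_weights_def)
  then show ?thesis by (simp add: weight_torus_eq[OF p] pair_circle_def)
qed

text \<open>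
  Uniqueness of barycentric coordinates turns the barycentric condition in the definition of
  the triple torus into a prescription of every modulus.
\<close>

lemma weight_torus_circumcenter_weights:
  assumes l: "inj l" and T: "card T = 3" "acute_triangle (l ` T)"
  shows "weight_torus (circumcenter_weights l T) = triple_torus l T"
proof -
  let ?p = "circumcenter_weights l T"
  have p: "prob_vector ?p" by (rule balanced_prob[OF balanced_circumcenter_weights[OF assms]])
  note supp = support_circumcenter_weights[OF assms]
  have "(\<forall>i. (cmod (u $ i))\<^sup>2 = ?p $ i) \<longleftrightarrow> norm u = 1 \<and>
      barycentric_coordinates l T (\<lambda>i. (cmod (u $ i))\<^sup>2) (circumcenter (l ` T)) \<and>
      (\<forall>m. m \<notin> T \<longrightarrow> u $ m = 0)" (is "?L u \<longleftrightarrow> ?R u") for u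
  proof
    assume u: "?L u"
    then have "norm u = 1" using norm_of_moduli[OF p] by blast
    moreover have "u $ m = 0" if "m \<notin> T" for m
      using u supp that by (metis (mono_tags, lifting) mem_Collect_eq norm_eq_zero zero_eq_power2)
    moreover have "(\<Sum>i\<in>T. ?p $ i) = 1" "(\<Sum>i\<in>T. ?p $ i *\<^sub>R l i) = circumcenter (l ` T)"
      using p mass_over_support[OF equalityD1[OF supp]] mean_over_support[OF equalityD1[OF supp], of l]
        mean_circumcenter_weights[OF assms] by (simp_all add: prob_vector_def)
    ultimately show "?R u" using u by (simp add: barycentric_coordinates_def)
  next
    assume u: "?R u"
    define q where "q = (\<chi> i. (cmod (u $ i))\<^sup>2)"
    have q: "support q \<subseteq> T" using u by (auto simp: q_def)
    have "?p = q"
    proof (rule barycentric_unique[OF l T(1) _ p _ _ q])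
      show "\<not> collinear (l ` T)" using T(2) by (simp add: acute_triangle_def nondegenerate_triangle_def)
      show "support ?p \<subseteq> T" using supp by simp
      show "prob_vector q" using u unfolding prob_vector_def mass_over_support[OF q]
        by (simp add: barycentric_coordinates_def q_def)
      show "mean l ?p = mean l q"
        using u unfolding mean_circumcenter_weights[OF assms] mean_over_support[OF q]
        by (simp add: barycentric_coordinates_def q_def)
    qed
    then show "?L u" by (simp add: q_def)
  qed
  then show ?thesis by (simp add: weight_torus_eq[OF p] triple_torus_def)
qed

lemma weight_torus_inject:
  assumes "prob_vector p" "weight_torus p = weight_torus q"
  shows "p = q"
  using weight_torus_nonempty[OF assms(1)] assms(2) by (auto simp: weight_torus_def)

text \<open>
  A connected set that contains one member cannot grow: the other members together form a closed
  set, so it would be split into two disjoint closed pieces.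
\<close>

lemma components_Union_closed_connected:
  fixes F :: "'a::topological_space set set"
  assumes "finite F" and F: "\<And>C. C \<in> F \<Longrightarrow> closed C \<and> connected C \<and> C \<noteq> {}"
    and disj: "\<And>C D. C \<in> F \<Longrightarrow> D \<in> F \<Longrightarrow> C \<noteq> D \<Longrightarrow> C \<inter> D = {}"
  shows "components (\<Union>F) = F"
proof -
  have comp: "C \<in> components (\<Union>F)" if C: "C \<in> F" for C
    unfolding in_components_maximal
  proof (intro conjI allI impI)
    fix D
    assume D: "D \<noteq> {} \<and> C \<subseteq> D \<and> D \<subseteq> \<Union>F \<and> connected D"
    let ?R = "\<Union>(F - {C})"
    have "closed ?R" using assms(1) F by (intro closed_Union) auto
    moreover have "C \<inter> ?R \<inter> D = {}" using disj C by blast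
    moreover have "D \<subseteq> C \<union> ?R" "C \<inter> D \<noteq> {}" using D F[OF C] by auto
    ultimately have "?R \<inter> D = {}"
      using D F[OF C] connected_closed[of D] by blast
    then show "D = C" using D by blast
  qed (use F C in auto)
  moreover have "D \<in> F" if D: "D \<in> components (\<Union>F)" for D
  proof -
    have "D \<noteq> {}" "D \<subseteq> \<Union>F" using D in_components_nonempty in_components_subset by blast+
    then obtain C where C: "C \<in> F" "C \<inter> D \<noteq> {}" by blast
    then have "C = D" using components_eq[OF comp[OF C(1)] D] by blast
    then show ?thesis using C by simp
  qed
  ultimately show ?thesis by blast
qed

theorem theorem4p7:
  fixes l :: "'n::finite \<Rightarrow> complex" and A :: "complex ^ 'n ^ 'n"
  assumes "A = diag_matrix l"
    and "inj l"
    and "general_position (range l)"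
  shows
    "critical_set (proj_rho A) =
       range eigenline
       \<union> (\<Union>P\<in>{P. card P = 2}. pair_circle P)
       \<union> (\<Union>T\<in>{T. card T = 3 \<and> acute_triangle (l ` T)}. triple_torus l T) \<and>
     components (critical_set (proj_rho A)) =
       {{eigenline i} | i. True}
       \<union> {pair_circle P | P. card P = 2}
       \<union> {triple_torus l T | T. card T = 3 \<and> acute_triangle (l ` T)} \<and>
     card (range (eigenline :: 'n \<Rightarrow> 'n cproj)) = CARD('n) \<and>
     (\<forall>i. eigenline i isolated_in critical_set (proj_rho A) \<and>
          (\<forall>L. proj_rho A (eigenline i) \<le> proj_rho A L)) \<and>
     inj_on pair_circle {P :: 'n set. card P = 2} \<and>
     card {pair_circle P | P :: 'n set. card P = 2} = CARD('n) choose 2 \<and>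
     (\<forall>P :: 'n set. card P = 2 \<longrightarrow> pair_circle P homeomorphic (torus :: (complex ^ 1) set)) \<and>
     inj_on (triple_torus l) {T. card T = 3 \<and> acute_triangle (l ` T)} \<and>
     (\<forall>T. card T = 3 \<and> acute_triangle (l ` T) \<longrightarrow>
          triple_torus l T homeomorphic (torus :: (complex ^ 2) set))"
proof -
  note l = assms(2)
  define \<T> where "\<T> = {T. card T = 3 \<and> acute_triangle (l ` T)}"
  define W where "W = range (\<lambda>i. axis i 1) \<union> pair_weights ` {P. card P = 2} \<union>
    circumcenter_weights l ` \<T>"
  have W: "balanced l p \<longleftrightarrow> p \<in> W" for p
    unfolding W_def \<T>_def by (rule balanced_iff[OF assms(2,3)])
  then have prob: "prob_vector p" if "p \<in> W" for p using that balanced_prob by blast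
  have "finite W" by (simp add: W_def)
  have crit: "critical_set (proj_rho A) = \<Union>(weight_torus ` W)"
    unfolding assms(1) critical_set_eq W by (auto simp: weight_torus_def)
  have pair: "weight_torus (pair_weights P) = pair_circle P" if "card P = 2" for P :: "'n set"
    using that by (rule weight_torus_pair_weights)
  have triple: "weight_torus (circumcenter_weights l T) = triple_torus l T" if "T \<in> \<T>" for T
    using that weight_torus_circumcenter_weights[OF l] by (simp add: \<T>_def)
  have supp: "support (circumcenter_weights l T) = T" if "T \<in> \<T>" for T
    using that support_circumcenter_weights[OF l] by (simp add: \<T>_def)
  have tori: "weight_torus ` W =
      {{eigenline i} | i. True} \<union> {pair_circle P | P. card P = 2} \<union> {triple_torus l T | T. T \<in> \<T>}"
  proof -
    have "weight_torus ` W = (\<lambda>i. weight_torus (axis i 1)) ` UNIV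
        \<union> (\<lambda>P. weight_torus (pair_weights P)) ` {P. card P = 2}
        \<union> (\<lambda>T. weight_torus (circumcenter_weights l T)) ` \<T>"
      by (simp add: W_def image_Un image_image)
    also have "\<dots> = (\<lambda>i. {eigenline i}) ` UNIV \<union> pair_circle ` {P. card P = 2} \<union> triple_torus l ` \<T>"
      by (simp add: pair triple weight_torus_axis cong: image_cong_simp)
    finally show ?thesis by (auto simp: image_def)
  qed
  have inject: "p = q" if "p \<in> W" "weight_torus p = weight_torus q" for p q
    using that prob weight_torus_inject by blast
  have axis_W: "axis i 1 \<in> W" and pair_W: "card P = 2 \<Longrightarrow> pair_weights P \<in> W"
    and triple_W: "T \<in> \<T> \<Longrightarrow> circumcenter_weights l T \<in> W" for i P T
    by (auto simp: W_def)

  have 1: "critical_set (proj_rho A) = range eigenline \<union> (\<Union>P\<in>{P. card P = 2}. pair_circle P)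
      \<union> (\<Union>T\<in>\<T>. triple_torus l T)"
    unfolding crit tori by auto
  have 2: "components (critical_set (proj_rho A)) = {{eigenline i} | i. True}
      \<union> {pair_circle P | P. card P = 2} \<union> {triple_torus l T | T. T \<in> \<T>}"
    unfolding tori[symmetric] crit
  proof (rule components_Union_closed_connected)
    show "finite (weight_torus ` W)" using \<open>finite W\<close> by simp
    show "closed C \<and> connected C \<and> C \<noteq> {}" if "C \<in> weight_torus ` W" for C
      using that prob closed_weight_torus connected_weight_torus weight_torus_nonempty by blast
    show "C \<inter> D = {}" if "C \<in> weight_torus ` W" "D \<in> weight_torus ` W" "C \<noteq> D" for C D
      using that by (auto simp: weight_torus_def)
  qed
  have 3: "card (range (eigenline :: 'n \<Rightarrow> 'n cproj)) = CARD('n)"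
  proof (rule card_image, rule injI)
    fix i j :: 'n
    assume "eigenline i = eigenline j"
    then have "axis i (1 :: real) = axis j 1"
      using inject[OF axis_W] by (simp add: weight_torus_axis)
    then show "i = j" by (simp add: axis_eq_axis)
  qed
  have 4: "eigenline i isolated_in critical_set (proj_rho A)" for i
  proof -
    let ?R = "\<Union>p\<in>W - {axis i 1}. weight_torus p"
    have "closed ?R" using \<open>finite W\<close> by (intro closed_UN) (auto intro: closed_weight_torus)
    moreover have "- ?R \<inter> critical_set (proj_rho A) = weight_torus (axis i 1)"
      using axis_W by (auto simp: crit weight_torus_def)
    ultimately show ?thesis
      unfolding isolated_in_def by (metis IntE insertI1 open_Compl weight_torus_axis)
  qed
  have 5: "proj_rho A (eigenline i) \<le> proj_rho A L" for i L
  proof -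
    have "weights (eigenline i) = axis i 1" using weight_torus_axis[of i] by (auto simp: weight_torus_def)
    moreover have "mean l (axis i 1) = l i"
      by (subst mean_over_support[of _ "{i}"]) (auto simp: axis_def)
    ultimately have "proj_rho A (eigenline i) = (\<Sum>j\<in>UNIV. (axis i 1 :: real ^ 'n) $ j * (cmod (l j - l i))\<^sup>2)"
      by (simp add: assms(1) proj_rho_diag_matrix variance_def)
    also have "\<dots> = 0" by (intro sum.neutral) (auto simp: axis_def)
    also have "0 \<le> proj_rho A L"
      using prob_vector_weights[of L]
      by (auto simp: assms(1) proj_rho_diag_matrix variance_def prob_vector_def intro!: sum_nonneg)
    finally show ?thesis .
  qed
  have 6: "inj_on pair_circle {P :: 'n set. card P = 2}"
  proof (rule inj_onI, simp only: mem_Collect_eq)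
    fix P Q :: "'n set"
    assume "card P = 2" "card Q = 2" "pair_circle P = pair_circle Q"
    then have "pair_weights P = pair_weights Q" using inject[OF pair_W] by (simp add: pair)
    then show "P = Q" by (metis support_pair_weights)
  qed
  have 7: "card {pair_circle P | P :: 'n set. card P = 2} = CARD('n) choose 2"
  proof -
    have "{pair_circle P | P :: 'n set. card P = 2} = pair_circle ` {P. card P = 2}" by auto
    then show ?thesis
      using card_image[OF 6] n_subsets[of "UNIV :: 'n set" 2] by simp
  qed
  have 8: "pair_circle P homeomorphic (torus :: (complex ^ 1) set)" if P: "card P = 2" for P :: "'n set"
    using weight_torus_homeomorphic_torus[OF prob[OF pair_W[OF P]], where 'k = 1]
    by (simp add: support_pair_weights P pair)
  have 9: "inj_on (triple_torus l) \<T>"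
  proof (rule inj_onI)
    fix S T
    assume ST: "S \<in> \<T>" "T \<in> \<T>" "triple_torus l S = triple_torus l T"
    then have eq: "circumcenter_weights l S = circumcenter_weights l T"
      using inject[OF triple_W] by (simp add: triple)
    have "S = support (circumcenter_weights l S)" by (rule supp[OF ST(1), symmetric])
    also have "\<dots> = support (circumcenter_weights l T)" by (simp only: eq)
    also have "\<dots> = T" by (rule supp[OF ST(2)])
    finally show "S = T" .
  qed
  have 10: "triple_torus l T homeomorphic (torus :: (complex ^ 2) set)" if T: "T \<in> \<T>" for T
  proof -
    have "card (support (circumcenter_weights l T)) = Suc CARD(2)"
      unfolding supp[OF T] using T by (simp add: \<T>_def)
    from weight_torus_homeomorphic_torus[OF prob[OF triple_W[OF T]] this]
    show ?thesis by (simp only: triple[OF T])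
  qed
  have "\<forall>i. eigenline i isolated_in critical_set (proj_rho A) \<and>
      (\<forall>L. proj_rho A (eigenline i) \<le> proj_rho A L)"
    using 4 5 by blast
  moreover have "\<forall>P :: 'n set. card P = 2 \<longrightarrow> pair_circle P homeomorphic (torus :: (complex ^ 1) set)"
    using 8 by blast
  moreover have "\<forall>T. T \<in> \<T> \<longrightarrow> triple_torus l T homeomorphic (torus :: (complex ^ 2) set)"
    using 10 by blast
  ultimately show ?thesis
    using 1 2 3 6 7 9 unfolding \<T>_def mem_Collect_eq by (intro conjI) assumption+
qed

end
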